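(* Let $X=Y=Z=\mathbb{R}^n$, let $H:\mathbb{R}^n\to\mathbb{R}$ be smooth and uniformly convex with Legendre transform $H^*(z)=\sup_{x\in\mathbb{R}^n}(x\cdot z-H(x))$, and set $h(x,z)=x\cdot z-H^*(z)$, $g(y,z)=y\cdot z$, and $b(x,y)=\sup_{z\in Z}\big(h(x,z)+g(y,z)\big)$. Then $b(x,y)=H(x+y)$, and for all $x,y,v,u\in\mathbb{R}^n$, $$MTW^b_{(x,y)}\langle v,u\rangle=-\sum_{i,j,k,l}\frac{\partial^4H^*}{\partial z^i\partial z^j\partial z^k\partial z^l}\,p_kp_lw_iw_j+2\sum_{i,j,k,l,a,r}\frac{\partial^3H^*}{\partial z^i\partial z^l\partial z^k}\,\frac{\partial^3H^*}{\partial z^r\partial z^j\partial z^a}\,\frac{\partial^2H}{\partial z^l\partial z^r}\,w_iw_jp_ap_k,$$ where $p=D^2H(x+y)\cdot u$, $w=D^2H(x+y)\cdot v$, the derivatives of $H^*$ are evaluated at $DH(x+y)$ and the second derivatives of $H$ are evaluated at $x+y$.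
   Context: Ma-Trudinger-Wang curvature: for $x,y\in\mathbb{R}^n$ and $v,u\in\mathbb{R}^n$, set $q=D_xb(x,y)$ and $p=(D^2_{xy}b(x,y))\cdot u$. The map $y\mapsto D_xb(x,y)$ is injective, and its inverse on its range is denoted $b\text{-exp}_x(\cdot)$. For any smooth curve $\beta(s)$ with $\beta(0)=x$ and $\frac{d\beta}{ds}(0)=v$, $$MTW^b_{(x,y)}\langle v,u\rangle:=\frac{\partial^4}{\partial s^2\partial t^2}\Big|_{s=t=0}b\big(\beta(s),b\text{-exp}_x(tp+q)\big)$$ (the value does not depend on the choice of $\beta$). Uniformly convex means that $D^2H\ge\lambda I$ on $\mathbb{R}^n$ for some $\lambda>0$. *)

theory Defs
  imports "HOL-Analysis.Analysis"
begin

text \<open>\<open>C\<^sup>k\<close> regularity on an open set \<open>S\<close> of a Euclidean space: every directional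
  derivative of order at most \<open>k\<close> exists and is continuous.\<close>

primrec Ck_on :: "nat \<Rightarrow> 'a::euclidean_space set \<Rightarrow> ('a \<Rightarrow> 'b::euclidean_space) \<Rightarrow> bool" where
  "Ck_on 0 S f \<longleftrightarrow> continuous_on S f"
| "Ck_on (Suc k) S f \<longleftrightarrow>
     (\<forall>x\<in>S. f differentiable (at x)) \<and>
     (\<forall>v. Ck_on k S (\<lambda>x. frechet_derivative f (at x) v))"

definition smooth_on :: "'a::euclidean_space set \<Rightarrow> ('a \<Rightarrow> 'b::euclidean_space) \<Rightarrow> bool" where
  "smooth_on S f \<longleftrightarrow> (\<forall>k. Ck_on k S f)"

definition partial :: "'n::finite \<Rightarrow> (real^'n \<Rightarrow> real) \<Rightarrow> real^'n \<Rightarrow> real" where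
  "partial i f x = deriv (\<lambda>t. f (x + t *\<^sub>R axis i 1)) 0"

definition grad :: "(real^'n \<Rightarrow> real) \<Rightarrow> real^'n \<Rightarrow> real^'n" where
  "grad f x = (\<chi> i. partial i f x)"

definition hessian :: "(real^'n \<Rightarrow> real) \<Rightarrow> real^'n \<Rightarrow> real^'n^'n" where
  "hessian f x = (\<chi> i j. partial i (partial j f) x)"

text \<open>\<open>D\<^sup>2H \<ge> cI\<close> as quadratic forms.\<close>

definition uniformly_convex :: "(real^'n \<Rightarrow> real) \<Rightarrow> bool" where
  "uniformly_convex H \<longleftrightarrow>
     (\<exists>c>0. \<forall>x \<xi>. c * (\<xi> \<bullet> \<xi>) \<le> \<xi> \<bullet> (hessian H x *v \<xi>))"

text \<open>Suprema here and in the definition of \<open>b\<close> are those of type \<^typ>\<open>real\<close>;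
  uniform convexity makes them finite.\<close>

definition legendre :: "(real^'n \<Rightarrow> real) \<Rightarrow> real^'n \<Rightarrow> real" where
  "legendre H z = (SUP x. x \<bullet> z - H x)"

definition grad_x :: "(real^'n \<Rightarrow> real^'n \<Rightarrow> real) \<Rightarrow> real^'n \<Rightarrow> real^'n \<Rightarrow> real^'n" where
  "grad_x b x y = grad (\<lambda>x'. b x' y) x"

definition mixed_hessian :: "(real^'n \<Rightarrow> real^'n \<Rightarrow> real) \<Rightarrow> real^'n \<Rightarrow> real^'n \<Rightarrow> real^'n^'n" where
  "mixed_hessian b x y = (\<chi> i j. partial i (\<lambda>x'. partial j (\<lambda>y'. b x' y') y) x)"

text \<open>When \<open>grad_x b x\<close> is injective, as it is in the setting of the MTW curvature,
  \<^const>\<open>inv\<close> is its inverse on its range.\<close>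

definition b_exp :: "(real^'n \<Rightarrow> real^'n \<Rightarrow> real) \<Rightarrow> real^'n \<Rightarrow> real^'n \<Rightarrow> real^'n" where
  "b_exp b x = inv (grad_x b x)"

definition smooth_curve_through :: "(real \<Rightarrow> real^'n) \<Rightarrow> real^'n \<Rightarrow> real^'n \<Rightarrow> bool" where
  "smooth_curve_through \<beta> x v \<longleftrightarrow>
     (\<exists>\<epsilon>>0. smooth_on {-\<epsilon><..<\<epsilon>} \<beta>) \<and> \<beta> 0 = x \<and> (\<beta> has_vector_derivative v) (at 0)"

text \<open>The common value, over all smooth curves \<open>\<beta>\<close> with \<open>\<beta>(0) = x\<close> and \<open>\<beta>'(0) = v\<close>,
  of the fourth derivative; the straight line shows that there is such a curve.\<close>

definition MTW ::
  "(real^'n \<Rightarrow> real^'n \<Rightarrow> real) \<Rightarrow> real^'n \<Rightarrow> real^'n \<Rightarrow> real^'n \<Rightarrow> real^'n \<Rightarrow> real" where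
  "MTW b x y v u =
     (let q = grad_x b x y; p = mixed_hessian b x y *v u in
      THE m. \<forall>\<beta>. smooth_curve_through \<beta> x v \<longrightarrow>
        (deriv ^^ 2) (\<lambda>s. (deriv ^^ 2) (\<lambda>t. b (\<beta> s) (b_exp b x (t *\<^sub>R p + q))) 0) 0 = m)"

end

theory Submission
  imports Defs
begin

text \<open>Uniform convexity makes \<open>DH\<close> a smooth diffeomorphism whose inverse is \<open>DH\<^sup>*\<close>, so
  \<open>b-exp\<^sub>x(z) = DH\<^sup>*(z) - x\<close>. Taking the \<open>s\<close>-derivatives of \<open>H(\<beta>(s) - x + DH\<^sup>*(q + tp))\<close> first
  gives \<open>v \<bullet> D\<^sup>2H(DH\<^sup>*(q + tp)) v + (q + tp) \<bullet> \<beta>''(0)\<close>; the second summand is affine in \<open>t\<close>,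
  whence the independence of \<open>\<beta>\<close>. The first is \<open>v \<bullet> w(t)\<close> where \<open>B(t) w(t) = v\<close> and
  \<open>B(t) = D\<^sup>2H\<^sup>*(q + tp)\<close>, and differentiating this equation twice gives
  \<open>v \<bullet> w'' = - w \<bullet> B'' w + 2 w \<bullet> B' B\<^sup>-\<^sup>1 B' w\<close>.\<close>

section \<open>Smooth functions and their partial derivatives\<close>

text \<open>Coinduction replaces the induction on the order \<open>k\<close> in \<^const>\<open>Ck_on\<close>.\<close>

coinductive psmooth :: "(real^'n \<Rightarrow> real) \<Rightarrow> bool" where
  psmoothI: "(\<And>x. f differentiable (at x)) \<Longrightarrow> (\<And>i. psmooth (partial i f)) \<Longrightarrow> psmooth f"

lemma psmooth_differentiable: "psmooth f \<Longrightarrow> f differentiable (at x)"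
  by (auto elim: psmooth.cases)

lemma psmooth_partial: "psmooth f \<Longrightarrow> psmooth (partial i f)"
  by (auto elim: psmooth.cases)

lemma partial_eq_has_derivative:
  assumes "(f has_derivative f') (at x)"
  shows "partial i f x = f' (axis i 1)"
proof -
  interpret bounded_linear f' using assms by (rule has_derivative_bounded_linear)
  have "((\<lambda>t. x + t *\<^sub>R axis i 1) has_derivative (\<lambda>t. t *\<^sub>R axis i 1)) (at 0)"
    by (auto intro!: derivative_eq_intros)
  moreover have "(f has_derivative f') (at (x + 0 *\<^sub>R axis i 1))"
    using assms by simp
  ultimately have "((\<lambda>t. f (x + t *\<^sub>R axis i 1)) has_derivative (\<lambda>t. f' (t *\<^sub>R axis i 1))) (at 0)"
    by (rule has_derivative_compose)
  then have "((\<lambda>t. f (x + t *\<^sub>R axis i 1)) has_real_derivative f' (axis i 1)) (at 0)"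
    by (simp add: has_field_derivative_def scale mult_commute_abs)
  then show ?thesis
    unfolding partial_def by (rule DERIV_imp_deriv)
qed

text \<open>Expanding the increment in the standard basis, linearity reduces the total derivative to
  its values on the axes, which are the partial derivatives. Existence of the total derivative is
  assumed, as partial derivatives alone would not give it.\<close>

lemma has_derivative_partial:
  assumes "f differentiable (at x)"
  shows "(f has_derivative (\<lambda>h. \<Sum>i\<in>UNIV. h $ i * partial i f x)) (at x)"
proof -
  obtain f' where f': "(f has_derivative f') (at x)"
    using assms by (auto simp: differentiable_def)
  then interpret bounded_linear f' by (rule has_derivative_bounded_linear)
  have "f' h = (\<Sum>i\<in>UNIV. h $ i * partial i f x)" for h
  proof -
    have "f' h = f' (\<Sum>i\<in>UNIV. h $ i *\<^sub>R axis i 1)"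
      by (simp add: basis_expansion flip: scalar_mult_eq_scaleR)
    also have "\<dots> = (\<Sum>i\<in>UNIV. h $ i * f' (axis i 1))"
      by (simp add: sum scale)
    finally show ?thesis
      by (simp add: partial_eq_has_derivative[OF f'])
  qed
  then have "f' = (\<lambda>h. \<Sum>i\<in>UNIV. h $ i * partial i f x)" ..
  with f' show ?thesis by simp
qed

lemma has_derivative_psmooth:
  "psmooth f \<Longrightarrow> (f has_derivative (\<lambda>h. \<Sum>i\<in>UNIV. h $ i * partial i f x)) (at x)"
  by (simp add: has_derivative_partial psmooth_differentiable)

lemma psmooth_isCont: "psmooth f \<Longrightarrow> isCont f x"
  using psmooth_differentiable differentiable_imp_continuous_within by blast

lemma partial_const: "partial i (\<lambda>x. c) = (\<lambda>x. 0)"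
  using partial_eq_has_derivative[OF has_derivative_const] by blast

lemma partial_add:
  assumes "f differentiable (at x)" "g differentiable (at x)"
  shows "partial i (\<lambda>x. f x + g x) x = partial i f x + partial i g x"
proof -
  obtain f' g' where D: "(f has_derivative f') (at x)" "(g has_derivative g') (at x)"
    using assms by (auto simp: differentiable_def)
  show ?thesis
    by (simp add: partial_eq_has_derivative[OF has_derivative_add[OF D]]
        partial_eq_has_derivative[OF D(1)] partial_eq_has_derivative[OF D(2)])
qed

lemma partial_mult:
  assumes "f differentiable (at x)" "g differentiable (at x)"
  shows "partial i (\<lambda>x. f x * g x) x = f x * partial i g x + partial i f x * g x"
proof -
  obtain f' g' where D: "(f has_derivative f') (at x)" "(g has_derivative g') (at x)"
    using assms by (auto simp: differentiable_def)
  show ?thesis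
    by (simp add: partial_eq_has_derivative[OF has_derivative_mult[OF D]]
        partial_eq_has_derivative[OF D(1)] partial_eq_has_derivative[OF D(2)])
qed

section \<open>Closure of smooth functions under algebraic operations\<close>

inductive_set algebra_generated :: "('a \<Rightarrow> real) set \<Rightarrow> ('a \<Rightarrow> real) set" for S where
  gen: "f \<in> S \<Longrightarrow> f \<in> algebra_generated S"
| const: "(\<lambda>x. c) \<in> algebra_generated S"
| add: "f \<in> algebra_generated S \<Longrightarrow> g \<in> algebra_generated S \<Longrightarrow> (\<lambda>x. f x + g x) \<in> algebra_generated S"
| mult: "f \<in> algebra_generated S \<Longrightarrow> g \<in> algebra_generated S \<Longrightarrow> (\<lambda>x. f x * g x) \<in> algebra_generated S"

text \<open>Closing up under sums and products first makes the set of candidates invariant under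
  \<^const>\<open>partial\<close>, as coinduction requires.\<close>

lemma psmooth_algebra_generated:
  assumes "\<And>f x. f \<in> S \<Longrightarrow> f differentiable (at x)"
    and "\<And>f i. f \<in> S \<Longrightarrow> partial i f \<in> algebra_generated S"
    and "f \<in> algebra_generated S"
  shows "psmooth f"
proof -
  have *: "(\<forall>x. f differentiable (at x)) \<and> (\<forall>i. partial i f \<in> algebra_generated S)"
    if "f \<in> algebra_generated S" for f
    using that
  proof induction
    case (const c)
    then show ?case by (simp add: partial_const algebra_generated.const)
  next
    case (add f g)
    moreover have "partial i (\<lambda>x. f x + g x) = (\<lambda>x. partial i f x + partial i g x)" for i
      using add by (intro ext partial_add) auto
    moreover have "(\<lambda>x. partial i f x + partial i g x) \<in> algebra_generated S" for i
      using add by (intro algebra_generated.add) auto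
    ultimately show ?case by simp
  next
    case (mult f g)
    moreover have "partial i (\<lambda>x. f x * g x) = (\<lambda>x. f x * partial i g x + partial i f x * g x)" for i
      using mult by (intro ext partial_mult) auto
    moreover have "(\<lambda>x. f x * partial i g x + partial i f x * g x) \<in> algebra_generated S" for i
      using mult by (intro algebra_generated.add algebra_generated.mult) auto
    ultimately show ?case by simp
  qed (use assms in auto)
  show ?thesis using assms(3)
  proof (coinduction arbitrary: f)
    case (psmooth f)
    from *[OF this] show ?case by blast
  qed
qed

lemma psmooth_algebra: "f \<in> algebra_generated {f. psmooth f} \<Longrightarrow> psmooth f"
  by (rule psmooth_algebra_generated[where S = "{f. psmooth f}"])
    (auto intro: psmooth_differentiable psmooth_partial algebra_generated.gen)

lemma psmooth_const: "psmooth (\<lambda>x. c)"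
  by (intro psmooth_algebra algebra_generated.const)

lemma psmooth_add: "psmooth f \<Longrightarrow> psmooth g \<Longrightarrow> psmooth (\<lambda>x. f x + g x)"
  by (intro psmooth_algebra algebra_generated.add algebra_generated.gen) simp_all

lemma psmooth_mult: "psmooth f \<Longrightarrow> psmooth g \<Longrightarrow> psmooth (\<lambda>x. f x * g x)"
  by (intro psmooth_algebra algebra_generated.mult algebra_generated.gen) simp_all

lemma psmooth_sum: "(\<And>a. a \<in> A \<Longrightarrow> psmooth (f a)) \<Longrightarrow> psmooth (\<lambda>x. \<Sum>a\<in>A. f a x)"
  by (induction A rule: infinite_finite_induct) (auto simp: psmooth_const psmooth_add)

lemma psmooth_prod: "(\<And>a. a \<in> A \<Longrightarrow> psmooth (f a)) \<Longrightarrow> psmooth (\<lambda>x. \<Prod>a\<in>A. f a x)"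
  by (induction A rule: infinite_finite_induct) (auto simp: psmooth_const psmooth_mult)

text \<open>The derivative of 1/f is a polynomial in 1/f and the partial derivatives of f. Adjoining
  the single generator 1/f to the smooth functions therefore gives an algebra stable under
  \<open>partial\<close>.\<close>

lemma psmooth_inverse:
  assumes f: "psmooth f" and nz: "\<And>x. f x \<noteq> 0"
  shows "psmooth (\<lambda>x. inverse (f x))"
proof (rule psmooth_algebra_generated[where S = "insert (\<lambda>x. inverse (f x)) {f. psmooth f}"])
  let ?A = "algebra_generated (insert (\<lambda>x. inverse (f x)) {f. psmooth f})"
  fix g i assume g: "g \<in> insert (\<lambda>x. inverse (f x)) {f. psmooth f}"
  have der: "((\<lambda>x. inverse (f x)) has_derivative
      (\<lambda>h. - (inverse (f x) * (\<Sum>i\<in>UNIV. h $ i * partial i f x) * inverse (f x)))) (at x)" for x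
    by (rule Deriv.has_derivative_inverse[OF nz has_derivative_psmooth[OF f]])
  show "g differentiable (at x)" for x
    using g der[of x] psmooth_differentiable by (auto simp: differentiable_def)
  \<comment> \<open>The sign is written as a constant factor because the algebra is built from
    constants, sums and products only.\<close>
  have "partial i (\<lambda>x. inverse (f x)) =
      (\<lambda>x. (-1) * ((inverse (f x) * partial i f x) * inverse (f x)))"
    by (rule ext, subst partial_eq_has_derivative[OF der])
      (simp add: axis_def if_distrib if_distribR cong: if_cong)
  moreover have inv: "(\<lambda>x. inverse (f x)) \<in> ?A"
    by (rule algebra_generated.gen) simp
  moreover have part: "partial i f' \<in> ?A" if "psmooth f'" for f'
    using that by (intro algebra_generated.gen) (simp add: psmooth_partial)
  have "(\<lambda>x. (-1) * ((inverse (f x) * partial i f x) * inverse (f x))) \<in> ?A"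
    by (intro algebra_generated.mult algebra_generated.const inv part f)
  ultimately show "partial i g \<in> ?A"
    using g part by auto
next
  show "(\<lambda>x. inverse (f x)) \<in> algebra_generated (insert (\<lambda>x. inverse (f x)) {f. psmooth f})"
    by (rule algebra_generated.gen) simp
qed

lemma psmooth_coordinate: "psmooth (\<lambda>x::real^'n. x $ k)"
proof (rule psmoothI)
  show "(\<lambda>x. x $ k) differentiable (at x)" for x :: "real^'n"
    by (intro bounded_linear_imp_differentiable bounded_linear_vec_nth)
  have "partial i (\<lambda>x. x $ k) = (\<lambda>x. axis i 1 $ k)" for i :: 'n
    by (rule ext, rule partial_eq_has_derivative,
        intro bounded_linear_imp_has_derivative bounded_linear_vec_nth)
  then show "psmooth (partial i (\<lambda>x. x $ k))" for i :: 'n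
    by (simp add: psmooth_const)
qed

text \<open>A partial derivative is the Frechet derivative in a fixed direction, and one order of
  \<open>Ck_on\<close> is spent on passing to it. Since all orders are available,
  \<open>smooth_on\<close> itself serves as the coinduction invariant.\<close>

lemma psmooth_smooth_on:
  assumes "smooth_on UNIV f"
  shows "psmooth f"
  using assms
proof (coinduction arbitrary: f)
  case (psmooth f)
  have Ck: "Ck_on k UNIV f" for k
    using psmooth by (simp add: smooth_on_def)
  have diff: "f differentiable (at x)" for x
    using Ck[of 1] by simp
  have "partial i f = (\<lambda>x. frechet_derivative f (at x) (axis i 1))" for i
    by (rule ext) (rule partial_eq_has_derivative[OF frechet_derivative_works[THEN iffD1, OF diff]])
  moreover have "smooth_on UNIV (\<lambda>x. frechet_derivative f (at x) v)" for v
    unfolding smooth_on_def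
  proof
    show "Ck_on k UNIV (\<lambda>x. frechet_derivative f (at x) v)" for k
      using Ck[of "Suc k"] by simp
  qed
  ultimately show ?case
    using diff by auto
qed

lemma psmooth_det:
  fixes M :: "real^'n \<Rightarrow> real^'m^'m"
  assumes "\<And>i j. psmooth (\<lambda>x. M x $ i $ j)"
  shows "psmooth (\<lambda>x. det (M x))"
  unfolding det_def by (intro psmooth_sum psmooth_mult psmooth_const psmooth_prod assms)

lemma has_real_derivative_psmooth_compose:
  assumes "psmooth f" and "(\<gamma> has_vector_derivative \<gamma>') (at t within S)"
  shows "((\<lambda>t. f (\<gamma> t)) has_real_derivative (\<Sum>i\<in>UNIV. partial i f (\<gamma> t) * \<gamma>' $ i)) (at t within S)"
proof -
  have "((\<lambda>t. f (\<gamma> t)) has_derivative (\<lambda>h. \<Sum>i\<in>UNIV. (h *\<^sub>R \<gamma>') $ i * partial i f (\<gamma> t))) (at t within S)"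
    using has_derivative_compose[OF assms(2)[unfolded has_vector_derivative_def]
        has_derivative_psmooth[OF assms(1)]] .
  then show ?thesis
    unfolding has_field_derivative_def
    by (rule has_derivative_eq_rhs) (simp add: fun_eq_iff sum_distrib_left mult_ac)
qed

section \<open>Symmetry of second partial derivatives\<close>

lemma second_difference_mvt:
  assumes f: "psmooth f" and "h > 0"
  obtains \<theta> \<eta> where "0 < \<theta>" "\<theta> < h" "0 < \<eta>" "\<eta> < h"
    "f (x + h *\<^sub>R axis i 1 + h *\<^sub>R axis j 1) - f (x + h *\<^sub>R axis i 1) - f (x + h *\<^sub>R axis j 1) + f x
      = h\<^sup>2 * partial j (partial i f) (x + \<theta> *\<^sub>R axis i 1 + \<eta> *\<^sub>R axis j 1)"
proof -
  have D: "((\<lambda>r. g (z + r *\<^sub>R axis k 1)) has_real_derivative partial k g (z + r *\<^sub>R axis k 1)) (at r)"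
    if "psmooth g" for g r k and z :: "real^'n"
  proof -
    have "((\<lambda>r. z + r *\<^sub>R axis k 1) has_vector_derivative axis k 1) (at r)"
      by (auto intro!: derivative_eq_intros simp: has_vector_derivative_def)
    from has_real_derivative_psmooth_compose[OF that this] show ?thesis
      by (simp add: axis_def if_distrib if_distribR cong: if_cong)
  qed
  \<comment> \<open>The second difference is the increment of \<open>?\<phi>\<close> over [0, h].
    One mean value theorem in direction i turns it into an increment of \<open>partial i f\<close>
    in direction j, and a second one treats that increment.\<close>
  let ?\<phi> = "\<lambda>r. f ((x + h *\<^sub>R axis j 1) + r *\<^sub>R axis i 1) - f (x + r *\<^sub>R axis i 1)"
  have "\<exists>\<theta>>0. \<theta> < h \<and> ?\<phi> h - ?\<phi> 0 = (h - 0) *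
      (partial i f ((x + h *\<^sub>R axis j 1) + \<theta> *\<^sub>R axis i 1) - partial i f (x + \<theta> *\<^sub>R axis i 1))"
    by (rule MVT2[OF \<open>h > 0\<close>]) (intro DERIV_diff D f)
  then obtain \<theta> where \<theta>: "0 < \<theta>" "\<theta> < h" "?\<phi> h - ?\<phi> 0 = h *
      (partial i f ((x + h *\<^sub>R axis j 1) + \<theta> *\<^sub>R axis i 1) - partial i f (x + \<theta> *\<^sub>R axis i 1))"
    by auto
  let ?\<psi> = "\<lambda>r. partial i f ((x + \<theta> *\<^sub>R axis i 1) + r *\<^sub>R axis j 1)"
  have "\<exists>\<eta>>0. \<eta> < h \<and> ?\<psi> h - ?\<psi> 0 = (h - 0) *
      partial j (partial i f) ((x + \<theta> *\<^sub>R axis i 1) + \<eta> *\<^sub>R axis j 1)"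
    by (rule MVT2[OF \<open>h > 0\<close>]) (intro D psmooth_partial f)
  then obtain \<eta> where \<eta>: "0 < \<eta>" "\<eta> < h" "?\<psi> h - ?\<psi> 0 = h *
      partial j (partial i f) ((x + \<theta> *\<^sub>R axis i 1) + \<eta> *\<^sub>R axis j 1)"
    by auto
  show ?thesis
    by (rule that[OF \<theta>(1,2) \<eta>(1,2)])
      (use \<theta>(3) \<eta>(3) in \<open>simp add: power2_eq_square algebra_simps\<close>)
qed

text \<open>The second difference is symmetric in i and j, so the two mixed derivatives agree at
  some pair of points within distance 2h of x. Letting h tend to 0, continuity gives equality at
  x.\<close>

lemma partial_commute:
  assumes f: "psmooth f"
  shows "partial i (partial j f) = partial j (partial i f)"
proof
  fix x
  let ?F = "partial i (partial j f)" and ?G = "partial j (partial i f)"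
  let ?P = "\<lambda>y z h. norm (y - x) \<le> 2 * h \<and> norm (z - x) \<le> 2 * h \<and> ?F y = ?G z"
  have ex: "\<exists>y z. ?P y z h" if "h > 0" for h
  proof -
    have small: "norm (x + a *\<^sub>R axis k 1 + c *\<^sub>R axis l 1 - x) \<le> 2 * h"
      if "0 < a" "a < h" "0 < c" "c < h" for a c k l
      using norm_triangle_ineq[of "a *\<^sub>R axis k (1::real)" "c *\<^sub>R axis l 1"] that
      by (simp add: algebra_simps norm_axis_1)
    obtain a c where ac: "0 < a" "a < h" "0 < c" "c < h"
      "f (x + h *\<^sub>R axis i 1 + h *\<^sub>R axis j 1) - f (x + h *\<^sub>R axis i 1) - f (x + h *\<^sub>R axis j 1) + f x
      = h\<^sup>2 * ?G (x + a *\<^sub>R axis i 1 + c *\<^sub>R axis j 1)"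
      using second_difference_mvt[OF f \<open>h > 0\<close>] .
    obtain a' c' where ac': "0 < a'" "a' < h" "0 < c'" "c' < h"
      "f (x + h *\<^sub>R axis j 1 + h *\<^sub>R axis i 1) - f (x + h *\<^sub>R axis j 1) - f (x + h *\<^sub>R axis i 1) + f x
      = h\<^sup>2 * ?F (x + a' *\<^sub>R axis j 1 + c' *\<^sub>R axis i 1)"
      using second_difference_mvt[OF f \<open>h > 0\<close>] .
    have "h\<^sup>2 * ?F (x + a' *\<^sub>R axis j 1 + c' *\<^sub>R axis i 1) = h\<^sup>2 * ?G (x + a *\<^sub>R axis i 1 + c *\<^sub>R axis j 1)"
      using ac(5) ac'(5) by (simp only: add.assoc add.commute[of "h *\<^sub>R axis j 1"])
    with \<open>h > 0\<close> have "?F (x + a' *\<^sub>R axis j 1 + c' *\<^sub>R axis i 1) = ?G (x + a *\<^sub>R axis i 1 + c *\<^sub>R axis j 1)"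
      by simp
    with small[OF ac(1-4)] small[OF ac'(1-4)] show ?thesis by blast
  qed
  \<comment> \<open>The step sizes h = 1/(n+1) turn the pairs of points into two sequences
    converging to x.\<close>
  then have "\<forall>n. \<exists>y z. ?P y z (inverse (real (Suc n)))"
    by simp
  then obtain Y Z where YZ: "?P (Y n) (Z n) (inverse (real (Suc n)))" for n
    by metis
  have lim: "(\<lambda>n. 2 * inverse (real (Suc n))) \<longlonglongrightarrow> 0"
    using tendsto_mult_right_zero[OF LIMSEQ_inverse_real_of_nat] .
  have "(\<lambda>n. Y n - x) \<longlonglongrightarrow> 0" "(\<lambda>n. Z n - x) \<longlonglongrightarrow> 0"
    using YZ by (auto intro!: Lim_null_comparison[OF always_eventually lim])
  then have "Y \<longlonglongrightarrow> x" "Z \<longlonglongrightarrow> x"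
    by (simp_all add: LIM_zero_iff)
  then have "(\<lambda>n. ?F (Y n)) \<longlonglongrightarrow> ?F x" "(\<lambda>n. ?G (Z n)) \<longlonglongrightarrow> ?G x"
    by (auto intro!: isCont_tendsto_compose[OF psmooth_isCont] psmooth_partial f)
  moreover have "(\<lambda>n. ?F (Y n)) = (\<lambda>n. ?G (Z n))"
    using YZ by auto
  ultimately show "?F x = ?G x"
    by (metis LIMSEQ_unique)
qed

section \<open>The Legendre transform of a uniformly convex function\<close>

lemma has_derivative_vec_componentwise:
  fixes f :: "'a::real_normed_vector \<Rightarrow> real^'n"
  assumes "\<And>i. ((\<lambda>x. f x $ i) has_derivative (\<lambda>h. f' h $ i)) (at x within S)"
  shows "(f has_derivative f') (at x within S)"
  using assms
  by (subst has_derivative_componentwise_within) (auto simp: Basis_vec_def inner_axis)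

lemma has_vector_derivative_vec_componentwise:
  fixes f :: "real \<Rightarrow> real^'n"
  assumes "\<And>i. ((\<lambda>x. f x $ i) has_real_derivative f' $ i) (at x within S)"
  shows "(f has_vector_derivative f') (at x within S)"
  unfolding has_vector_derivative_def
  by (rule has_derivative_vec_componentwise)
    (rule has_derivative_eq_rhs[OF assms[unfolded has_field_derivative_def]], simp add: fun_eq_iff)

lemma has_real_derivative_vec_nth:
  assumes "(f has_vector_derivative f') (at x within S)"
  shows "((\<lambda>x. f x $ i) has_real_derivative f' $ i) (at x within S)"
  using bounded_linear.has_vector_derivative[OF bounded_linear_vec_nth assms]
  by (simp add: has_real_derivative_iff_has_vector_derivative)

lemma has_derivative_inner_grad:
  "psmooth f \<Longrightarrow> (f has_derivative (\<lambda>h. h \<bullet> grad f x)) (at x)"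
  by (rule has_derivative_eq_rhs[OF has_derivative_psmooth]) (simp_all add: inner_vec_def grad_def)

lemma transpose_hessian: "psmooth f \<Longrightarrow> transpose (hessian f x) = hessian f x"
  by (simp add: transpose_def hessian_def vec_eq_iff partial_commute)

text \<open>The Jacobian of the gradient has the indices of \<open>hessian\<close> in the opposite
  order; symmetry of second derivatives reconciles them.\<close>

lemma has_derivative_grad:
  assumes "psmooth f"
  shows "(grad f has_derivative (*v) (hessian f x)) (at x)"
proof (rule has_derivative_vec_componentwise)
  fix i
  have "(partial i f has_derivative (\<lambda>h. \<Sum>j\<in>UNIV. h $ j * partial j (partial i f) x)) (at x)"
    by (intro has_derivative_psmooth psmooth_partial assms)
  also have "(\<lambda>h. \<Sum>j\<in>UNIV. h $ j * partial j (partial i f) x) = (\<lambda>h. (hessian f x *v h) $ i)"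
    by (simp add: fun_eq_iff hessian_def matrix_vector_mult_def partial_commute[OF assms, of i] mult.commute)
  finally show "((\<lambda>x. grad f x $ i) has_derivative (\<lambda>h. (hessian f x *v h) $ i)) (at x)"
    by (simp add: grad_def)
qed

section \<open>Strong monotonicity and bijectivity of the gradient\<close>

locale uniformly_convex_potential =
  fixes H :: "real^'n \<Rightarrow> real" and c :: real
  assumes smooth: "psmooth H"
    and c_pos: "c > 0"
    and hessian_ge: "\<And>x \<xi>. c * (\<xi> \<bullet> \<xi>) \<le> \<xi> \<bullet> (hessian H x *v \<xi>)"
begin

text \<open>Taylor expansion of order two along the segment from x to y, with the remainder bounded
  below by the Hessian condition.\<close>

lemma tangent_below: "H x + (y - x) \<bullet> grad H x + c / 2 * (norm (y - x))\<^sup>2 \<le> H y"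
proof -
  define d where "d = y - x"
  define diff :: "nat \<Rightarrow> real \<Rightarrow> real" where "diff = (\<lambda>m t.
    if m = 0 then H (x + t *\<^sub>R d) else if m = 1 then \<Sum>i\<in>UNIV. partial i H (x + t *\<^sub>R d) * d $ i
    else \<Sum>i\<in>UNIV. (\<Sum>j\<in>UNIV. partial j (partial i H) (x + t *\<^sub>R d) * d $ j) * d $ i)"
  have line: "((\<lambda>t. x + t *\<^sub>R d) has_vector_derivative d) (at t)" for t
    by (auto intro!: derivative_eq_intros simp: has_vector_derivative_def)
  have "DERIV (diff m) t :> diff (Suc m) t" if "m < 2" for m t
  proof (cases m)
    case 0
    then show ?thesis
      using has_real_derivative_psmooth_compose[OF smooth line] by (simp add: diff_def)
  next
    case (Suc k)
    with that have "m = 1" by simp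
    then show ?thesis
      unfolding diff_def
      by (simp, intro DERIV_sum DERIV_cmult_right
          has_real_derivative_psmooth_compose[OF psmooth_partial[OF smooth] line])
  qed
  then obtain t where t: "diff 0 1 = (\<Sum>m<2. (diff m 0 / fact m) * (1 - 0)^m) + (diff 2 t / fact 2) * (1 - 0)^2"
    using Taylor_up[of 2 diff "diff 0" 0 1 0] by auto
  have "diff 2 t = d \<bullet> (hessian H (x + t *\<^sub>R d) *v d)"
    by (simp add: diff_def inner_vec_def matrix_vector_mult_def hessian_def partial_commute[OF smooth] mult_ac)
  then have "c * (d \<bullet> d) \<le> diff 2 t"
    by (simp add: hessian_ge)
  moreover have "diff 0 1 = H y" "diff 0 0 = H x" "diff 1 0 = d \<bullet> grad H x"
    by (simp_all add: diff_def d_def inner_vec_def grad_def mult.commute)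
  ultimately show ?thesis
    using t by (simp add: numeral_2_eq_2 power2_norm_eq_inner[unfolded power2_eq_square] flip: d_def)
qed

text \<open>Adding the tangent inequalities at x and at y cancels the values of H.\<close>

lemma grad_strongly_monotone: "c * (norm (y - x))\<^sup>2 \<le> (y - x) \<bullet> (grad H y - grad H x)"
  using tangent_below[of x y] tangent_below[of y x]
  by (simp add: norm_minus_commute inner_diff algebra_simps)

lemma norm_diff_le_grad: "c * norm (y - x) \<le> norm (grad H y - grad H x)"
proof (cases "y = x")
  case False
  have "c * (norm (y - x))\<^sup>2 \<le> norm (y - x) * norm (grad H y - grad H x)"
    using grad_strongly_monotone[of y x] norm_cauchy_schwarz[of "y - x"] order_trans by blast
  with False show ?thesis
    by (simp add: power2_eq_square mult.left_commute)
qed simp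

lemma inj_grad: "inj (grad H)"
proof (rule injI)
  fix x y assume "grad H x = grad H y"
  with norm_diff_le_grad[of x y] c_pos show "x = y"
    by (simp add: mult_le_0_iff)
qed

text \<open>A given z is the gradient of H at a minimiser of H(x) - x \<bullet> z. Such a minimiser
  exists because quadratic growth confines the search to a compact ball.\<close>

lemma surj_grad: "surj (grad H)"
proof -
  have "\<exists>x. z = grad H x" for z
  proof -
    define f where "f = (\<lambda>x. H x - x \<bullet> z)"
    \<comment> \<open>K bounds the slope of f at 0. Beyond radius 2K/c the quadratic term c/2 |x|^2
      outweighs the linear loss K |x|, so f(x) is at least f(0) there.\<close>
    define K where "K = norm (grad H 0 - z)"
    have "continuous_on (cball 0 (2 * K / c)) f"
      unfolding f_def
      by (intro continuous_intros continuous_at_imp_continuous_on ballI psmooth_isCont smooth)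
    moreover have "cball 0 (2 * K / c) \<noteq> ({} :: (real^'n) set)"
      using c_pos by (simp add: K_def not_less)
    ultimately obtain x0 where x0: "x0 \<in> cball 0 (2 * K / c)" "\<And>x. x \<in> cball 0 (2 * K / c) \<Longrightarrow> f x0 \<le> f x"
      using continuous_attains_inf[of "cball 0 (2 * K / c)" f] by auto
    have "f x0 \<le> f x" for x
    proof (cases "x \<in> cball 0 (2 * K / c)")
      case False
      then have "2 * K < c * norm x"
        using c_pos by (simp add: field_simps)
      then have "norm x * K \<le> norm x * (c / 2 * norm x)"
        by (intro mult_left_mono) auto
      moreover have "- (norm x * K) \<le> x \<bullet> (grad H 0 - z)"
        using Cauchy_Schwarz_ineq2[of x "grad H 0 - z"] by (simp add: K_def abs_le_iff)
      moreover have "f 0 + x \<bullet> (grad H 0 - z) + c / 2 * (norm x)\<^sup>2 \<le> f x"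
        using tangent_below[of 0 x] by (simp add: f_def inner_diff algebra_simps)
      ultimately have "f 0 \<le> f x"
        by (simp add: power2_eq_square algebra_simps)
      moreover have "f x0 \<le> f 0"
        using x0(2)[of 0] c_pos by (simp add: K_def)
      ultimately show ?thesis by simp
    qed (use x0 in simp)
    moreover have "(f has_derivative (\<lambda>h. h \<bullet> grad H x0 - h \<bullet> z)) (at x0)"
      unfolding f_def by (auto intro!: derivative_eq_intros has_derivative_inner_grad smooth)
    \<comment> \<open>The minimum over the ball is now a global one, so the derivative vanishes even
      if x0 lies on the boundary of the ball.\<close>
    ultimately have "(\<lambda>h. h \<bullet> grad H x0 - h \<bullet> z) = (\<lambda>h. 0)"
      by (intro differential_zero_maxmin[of x0 UNIV f]) auto
    then have "h \<bullet> (grad H x0 - z) = 0" for h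
      by (metis inner_diff_right)
    then have "grad H x0 = z"
      by (metis inner_eq_zero_iff eq_iff_diff_eq_0)
    then show ?thesis by blast
  qed
  then show ?thesis by (auto simp: surj_def)
qed

section \<open>The inverse gradient, which is DH*, and Fenchel duality\<close>

definition grad_inv :: "real^'n \<Rightarrow> real^'n" where
  "grad_inv = inv (grad H)"

lemma grad_inv_grad [simp]: "grad_inv (grad H x) = x"
  by (simp add: grad_inv_def inj_grad)

lemma grad_grad_inv [simp]: "grad H (grad_inv z) = z"
  by (simp add: grad_inv_def surj_grad surj_f_inv_f)

lemma grad_inv_lipschitz: "c * norm (grad_inv y - grad_inv x) \<le> norm (y - x)"
  using norm_diff_le_grad[of "grad_inv y" "grad_inv x"] by simp

lemma continuous_grad_inv: "isCont grad_inv z"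
proof -
  have "norm (grad_inv y - grad_inv z) \<le> norm (y - z) / c" for y
    using grad_inv_lipschitz[of y z] c_pos by (simp add: field_simps)
  moreover have "((\<lambda>y. norm (y - z) / c) \<longlongrightarrow> norm (z - z) / c) (at z)"
    using c_pos by (intro tendsto_intros) auto
  ultimately have "((\<lambda>y. grad_inv y - grad_inv z) \<longlongrightarrow> 0) (at z)"
    by (auto intro!: Lim_null_comparison[where g = "\<lambda>y. norm (y - z) / c"])
  then show ?thesis
    by (simp add: isCont_def LIM_zero_iff)
qed

text \<open>This is the tangent inequality at \<open>grad_inv z\<close>, where the gradient of H
  equals z. It shows that the supremum defining H*(z) is attained there.\<close>

lemma legendre_ge: "x \<bullet> z - H x \<le> grad_inv z \<bullet> z - H (grad_inv z)"
proof -
  have "0 \<le> c / 2 * (norm (x - grad_inv z))\<^sup>2"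
    using c_pos by simp
  with tangent_below[of "grad_inv z" x] show ?thesis
    by (simp add: inner_diff algebra_simps)
qed

lemma legendre_eq: "legendre H z = grad_inv z \<bullet> z - H (grad_inv z)"
  unfolding legendre_def by (rule cSup_eq_maximum) (auto intro: legendre_ge)

text \<open>The Fenchel inequality gives the upper bound, and z = DH(x) attains it.\<close>

lemma biconjugate: "(SUP z. x \<bullet> z - legendre H z) = H x"
proof (rule cSup_eq_maximum)
  have "H x = x \<bullet> grad H x - legendre H (grad H x)"
    by (simp add: legendre_eq)
  then show "H x \<in> range (\<lambda>z. x \<bullet> z - legendre H z)"
    by blast
  fix a assume "a \<in> range (\<lambda>z. x \<bullet> z - legendre H z)"
  then show "a \<le> H x"
    using legendre_ge[of x] by (auto simp: legendre_eq algebra_simps)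
qed

text \<open>The subgradient inequalities for H* at z and at y squeeze its increment between (y - z)
  \<bullet> \<open>grad_inv z\<close> and (y - z) \<bullet> \<open>grad_inv y\<close>. Continuity of
  \<open>grad_inv\<close> makes the gap o(|y - z|).\<close>

lemma has_derivative_legendre: "(legendre H has_derivative (\<lambda>h. h \<bullet> grad_inv z)) (at z)"
proof -
  have lower: "(y - z) \<bullet> grad_inv z \<le> legendre H y - legendre H z" for y z
    using legendre_ge[of "grad_inv z" y] by (simp add: legendre_eq inner_diff inner_commute algebra_simps)
  have upper: "norm ((legendre H y - legendre H z) - (y - z) \<bullet> grad_inv z)
      \<le> norm (grad_inv y - grad_inv z) * norm (y - z)" for y
  proof -
    have "legendre H y - legendre H z \<le> (y - z) \<bullet> grad_inv y"
      using lower[of z y] by (simp add: inner_diff algebra_simps)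
    then have "\<bar>(legendre H y - legendre H z) - (y - z) \<bullet> grad_inv z\<bar> \<le> (y - z) \<bullet> (grad_inv y - grad_inv z)"
      using lower[of y z] by (simp add: inner_diff_right)
    also have "\<dots> \<le> norm (grad_inv y - grad_inv z) * norm (y - z)"
      using norm_cauchy_schwarz[of "y - z" "grad_inv y - grad_inv z"] by (simp only: mult.commute)
    finally show ?thesis by simp
  qed
  have "((\<lambda>y. norm (grad_inv y - grad_inv z)) \<longlongrightarrow> norm (grad_inv z - grad_inv z)) (at z)"
    using continuous_grad_inv[of z] by (intro tendsto_intros) (simp add: isCont_def)
  then have "((\<lambda>y. norm (grad_inv y - grad_inv z)) \<longlongrightarrow> 0) (at z)"
    by simp
  then have "((\<lambda>y. ((legendre H y - legendre H z) - (y - z) \<bullet> grad_inv z) /\<^sub>R norm (y - z)) \<longlongrightarrow> 0) (at z)"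
  proof (rule Lim_null_comparison[rotated])
    show "\<forall>\<^sub>F y in at z. norm (((legendre H y - legendre H z) - (y - z) \<bullet> grad_inv z) /\<^sub>R norm (y - z))
        \<le> norm (grad_inv y - grad_inv z)"
      unfolding eventually_at_filter
    proof (intro always_eventually allI impI)
      fix y assume "y \<noteq> z"
      then have "norm (y - z) > 0" by simp
      with upper[of y] show "norm (((legendre H y - legendre H z) - (y - z) \<bullet> grad_inv z) /\<^sub>R norm (y - z))
        \<le> norm (grad_inv y - grad_inv z)"
        by (simp add: divide_simps)
    qed
  qed
  then show ?thesis
    by (simp add: has_derivative_at_within bounded_linear_inner_left has_derivative_def Lim_ident_at)
qed

lemma partial_legendre: "partial i (legendre H) = (\<lambda>z. grad_inv z $ i)"
  by (rule ext, subst partial_eq_has_derivative[OF has_derivative_legendre]) (simp add: inner_axis')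

section \<open>Inverse Hessian and smoothness of the Legendre transform\<close>

lemma invertible_hessian: "invertible (hessian H x)"
proof -
  have "\<xi> = 0" if "hessian H x *v \<xi> = 0" for \<xi>
    using hessian_ge[of \<xi> x] that c_pos by (simp add: mult_le_0_iff flip: power2_norm_eq_inner)
  then show ?thesis
    by (simp add: invertible_left_inverse matrix_left_invertible_ker)
qed

lemma matrix_inv_hessian:
  "matrix_inv (hessian H x) ** hessian H x = mat 1" "hessian H x ** matrix_inv (hessian H x) = mat 1"
  using someI_ex[OF invertible_hessian[unfolded invertible_def], of x]
  by (simp_all add: matrix_inv_def)

text \<open>By Cramer's rule each entry of the inverse is a quotient of determinants, with a
  denominator that never vanishes.\<close>

lemma psmooth_matrix_inv_hessian: "psmooth (\<lambda>x. matrix_inv (hessian H x) $ i $ j)"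
proof -
  let ?M = "\<lambda>x. hessian H x"
  \<comment> \<open>Column j of the inverse solves \<open>?M x *v y = axis j 1\<close>;
    \<open>?C x\<close> is the Cramer matrix for its component i.\<close>
  let ?C = "\<lambda>x. (\<chi> k l. if l = i then axis j 1 $ k else ?M x $ k $ l) :: real^'n^'n"
  have nz: "det (?M x) \<noteq> 0" for x
    using invertible_hessian by (simp add: invertible_det_nz)
  have "matrix_inv (?M x) $ i $ j = det (?C x) * inverse (det (?M x))" for x
  proof -
    have "?M x *v (matrix_inv (?M x) *v axis j 1) = axis j 1"
      by (simp add: matrix_vector_mul_assoc matrix_inv_hessian)
    then have "matrix_inv (?M x) *v axis j 1 =
        (\<chi> k. det (\<chi> m l. if l = k then axis j 1 $ m else ?M x $ m $ l) / det (?M x))"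
      by (rule cramer[OF nz, THEN iffD1])
    then have "(matrix_inv (?M x) *v axis j 1) $ i = det (?C x) / det (?M x)"
      by simp
    then show ?thesis
      by (simp add: matrix_vector_mult_basis column_def divide_inverse)
  qed
  moreover have M: "psmooth (\<lambda>x. ?M x $ k $ l)" for k l
    by (simp add: hessian_def psmooth_partial smooth)
  then have "psmooth (\<lambda>x. ?C x $ k $ l)" for k l
    by (cases "l = i") (simp_all add: psmooth_const)
  then have "psmooth (\<lambda>x. det (?C x) * inverse (det (?M x)))"
    by (intro psmooth_mult psmooth_inverse psmooth_det M nz)
  ultimately show ?thesis by simp
qed

lemma has_derivative_grad_inv: "(grad_inv has_derivative (*v) (matrix_inv (hessian H (grad_inv z)))) (at z)"
proof (rule has_derivative_inverse_basic[where f = "grad H"])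
  show "(grad H has_derivative (*v) (hessian H (grad_inv z))) (at (grad_inv z))"
    by (rule has_derivative_grad[OF smooth])
  show "(*v) (matrix_inv (hessian H (grad_inv z))) \<circ> (*v) (hessian H (grad_inv z)) = id"
    by (auto simp: fun_eq_iff matrix_vector_mul_assoc matrix_inv_hessian)
  show "z \<in> UNIV" by simp
qed (simp_all add: continuous_grad_inv matrix_vector_mul_bounded_linear)

text \<open>By the chain rule and the inverse function theorem, a partial derivative of f composed
  with \<open>grad_inv\<close> is again a smooth function composed with \<open>grad_inv\<close>.
  This shape is the coinduction invariant.\<close>

lemma psmooth_comp_grad_inv:
  assumes "psmooth f"
  shows "psmooth (\<lambda>z. f (grad_inv z))"
proof -
  have "psmooth g" if "\<exists>f. psmooth f \<and> g = (\<lambda>z. f (grad_inv z))" for g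
    using that
  proof (coinduction arbitrary: g)
    case (psmooth g)
    then obtain f where f: "psmooth f" "g = (\<lambda>z. f (grad_inv z))" by blast
    let ?N = "\<lambda>x. matrix_inv (hessian H x)"
    have D: "(g has_derivative (\<lambda>h. \<Sum>l\<in>UNIV. (?N (grad_inv z) *v h) $ l * partial l f (grad_inv z))) (at z)" for z
      unfolding f(2)
      using has_derivative_compose[OF has_derivative_grad_inv has_derivative_psmooth[OF f(1)]] .
    have "partial i g = (\<lambda>z. (\<lambda>x. \<Sum>l\<in>UNIV. ?N x $ l $ i * partial l f x) (grad_inv z))" for i
      by (rule ext, subst partial_eq_has_derivative[OF D]) (simp add: matrix_vector_mult_basis column_def)
    moreover have "psmooth (\<lambda>x. \<Sum>l\<in>UNIV. ?N x $ l $ i * partial l f x)" for i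
      by (intro psmooth_sum psmooth_mult psmooth_matrix_inv_hessian psmooth_partial f(1))
    moreover have "g differentiable (at z)" for z
      using D by (auto simp: differentiable_def)
    ultimately show ?case by blast
  qed
  with assms show ?thesis by blast
qed

lemma psmooth_legendre: "psmooth (legendre H)"
proof (rule psmoothI)
  show "legendre H differentiable (at z)" for z
    using has_derivative_legendre by (auto simp: differentiable_def)
  show "psmooth (partial i (legendre H))" for i
    unfolding partial_legendre by (rule psmooth_comp_grad_inv[OF psmooth_coordinate])
qed

text \<open>The gradient of H* is \<open>grad_inv\<close>, whose Jacobian is the inverse Hessian.
  This yields the transpose first, and symmetry of the Hessian of H* removes it.\<close>

lemma hessian_legendre: "hessian (legendre H) z = matrix_inv (hessian H (grad_inv z))"
proof -
  have "partial i (partial j (legendre H)) z = matrix_inv (hessian H (grad_inv z)) $ j $ i" for i j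
  proof -
    have "((\<lambda>z. grad_inv z $ j) has_derivative (\<lambda>h. (matrix_inv (hessian H (grad_inv z)) *v h) $ j)) (at z)"
      by (rule bounded_linear.has_derivative[OF bounded_linear_vec_nth has_derivative_grad_inv])
    from partial_eq_has_derivative[OF this] show ?thesis
      by (simp add: partial_legendre matrix_vector_mult_basis column_def)
  qed
  then have "transpose (hessian (legendre H) z) = matrix_inv (hessian H (grad_inv z))"
    by (simp add: transpose_def vec_eq_iff hessian_def[of "legendre H"])
  then show ?thesis
    by (simp add: transpose_hessian psmooth_legendre)
qed

lemma hessian_legendre_hessian: "hessian (legendre H) (grad H x) ** hessian H x = mat 1"
  by (simp add: hessian_legendre matrix_inv_hessian)

end

section \<open>Second derivatives along curves\<close>

lemma partial_sum:
  assumes "\<And>a. a \<in> A \<Longrightarrow> psmooth (f a)"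
  shows "partial k (\<lambda>x. \<Sum>a\<in>A. f a x) = (\<lambda>x. \<Sum>a\<in>A. partial k (f a) x)"
  using assms
  by (induction A rule: infinite_finite_induct)
    (simp_all add: partial_const partial_add psmooth_differentiable psmooth_sum fun_eq_iff)

lemma partial_cmult:
  assumes "psmooth f"
  shows "partial k (\<lambda>x. f x * c) = (\<lambda>x. partial k f x * c)"
  by (simp add: fun_eq_iff partial_mult psmooth_differentiable[OF assms]
      psmooth_differentiable[OF psmooth_const] partial_const)

lemma partial_add_psmooth:
  assumes "psmooth f" "psmooth g"
  shows "partial k (\<lambda>x. f x + g x) = (\<lambda>x. partial k f x + partial k g x)"
  by (simp add: fun_eq_iff partial_add psmooth_differentiable assms)

text \<open>The first derivative is required on a neighbourhood of \<open>a\<close>, since the outer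
  \<open>deriv\<close> sees \<open>deriv f\<close> near \<open>a\<close>.\<close>

lemma deriv2_eqI:
  fixes f :: "real \<Rightarrow> real"
  assumes "open S" "a \<in> S" and f': "\<And>t. t \<in> S \<Longrightarrow> (f has_real_derivative f' t) (at t)"
    and f'': "(f' has_real_derivative f'') (at a)"
  shows "(deriv ^^ 2) f a = f''"
proof -
  have "(deriv f has_real_derivative f'') (at a)"
    by (rule has_field_derivative_transform_within_open[OF f'' assms(1,2)])
      (simp add: DERIV_imp_deriv[OF f'])
  then show ?thesis
    by (simp add: numeral_2_eq_2 DERIV_imp_deriv)
qed

text \<open>The second derivative of \<open>f\<close> along a curve with velocity \<open>v\<close> and acceleration \<open>a\<close>. Two such operators commute, which is what exchanges the \<open>s\<close>- and \<open>t\<close>-derivatives.\<close>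

definition second_order :: "(real^'n \<Rightarrow> real) \<Rightarrow> real^'n \<Rightarrow> real^'n \<Rightarrow> real^'n \<Rightarrow> real" where
  "second_order f v a x =
    (\<Sum>i\<in>UNIV. (\<Sum>j\<in>UNIV. partial j (partial i f) x * v $ j) * v $ i + partial i f x * a $ i)"

text \<open>Chain rule applied twice. The open set S accommodates curves that are smooth only near
  0.\<close>

lemma deriv2_psmooth_compose:
  assumes f: "psmooth f" and S: "open S" "0 \<in> S"
    and \<gamma>': "\<And>t. t \<in> S \<Longrightarrow> (\<gamma> has_vector_derivative \<gamma>' t) (at t)"
    and \<gamma>'': "(\<gamma>' has_vector_derivative a) (at 0)"
  shows "(deriv ^^ 2) (\<lambda>t. f (\<gamma> t)) 0 = second_order f (\<gamma>' 0) a (\<gamma> 0)"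
proof (rule deriv2_eqI[OF S])
  show "((\<lambda>t. f (\<gamma> t)) has_real_derivative (\<Sum>i\<in>UNIV. partial i f (\<gamma> t) * \<gamma>' t $ i)) (at t)"
    if "t \<in> S" for t
    by (rule has_real_derivative_psmooth_compose[OF f \<gamma>'[OF that]])
  show "((\<lambda>t. \<Sum>i\<in>UNIV. partial i f (\<gamma> t) * \<gamma>' t $ i) has_real_derivative
      second_order f (\<gamma>' 0) a (\<gamma> 0)) (at 0)"
    unfolding second_order_def
    by (intro DERIV_sum, rule DERIV_cong, rule DERIV_mult,
        rule has_real_derivative_psmooth_compose[OF psmooth_partial[OF f] \<gamma>'[OF S(2)]],
        rule has_real_derivative_vec_nth[OF \<gamma>'']) (simp add: mult.commute)
qed

lemma second_order_const: "second_order (\<lambda>x. c) v a x = 0"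
  by (simp add: second_order_def partial_const)

lemma second_order_add:
  assumes "psmooth f" "psmooth g"
  shows "second_order (\<lambda>x. f x + g x) v a x = second_order f v a x + second_order g v a x"
  by (simp add: second_order_def partial_add_psmooth psmooth_partial assms sum.distrib algebra_simps)

lemma second_order_cmult:
  assumes "psmooth f"
  shows "second_order (\<lambda>x. f x * c) v a x = second_order f v a x * c"
  unfolding second_order_def
  by (simp add: partial_cmult psmooth_partial assms)
    (simp add: sum.distrib sum_distrib_left sum_distrib_right algebra_simps)

lemma second_order_sum:
  assumes "\<And>i. i \<in> A \<Longrightarrow> psmooth (f i)"
  shows "second_order (\<lambda>x. \<Sum>i\<in>A. f i x) v a x = (\<Sum>i\<in>A. second_order (f i) v a x)"
  using assms
  by (induction A rule: infinite_finite_induct)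
    (simp_all add: second_order_const second_order_add psmooth_sum)

lemma psmooth_second_order: "psmooth f \<Longrightarrow> psmooth (second_order f v a)"
  unfolding second_order_def[abs_def]
  by (intro psmooth_sum psmooth_add psmooth_mult psmooth_const psmooth_partial)

lemma partial_second_order:
  assumes "psmooth f"
  shows "partial k (second_order f v a) = second_order (partial k f) v a"
proof -
  note [simp] = psmooth_partial psmooth_sum psmooth_mult psmooth_const psmooth_add assms
  have 1: "partial k (partial j (partial i f)) = partial j (partial i (partial k f))" for i j
    by (metis partial_commute psmooth_partial assms)
  have 2: "partial k (partial i f) = partial i (partial k f)" for i
    by (rule partial_commute[OF assms])
  show ?thesis
    unfolding second_order_def[abs_def]
    by (simp add: partial_sum partial_add_psmooth partial_cmult 1) (simp add: 2)
qed

text \<open>For fixed v and a these are differential operators with constant coefficients, so they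
  commute because partial derivatives do.\<close>

lemma second_order_commute:
  assumes "psmooth f"
  shows "second_order (second_order f v a) v' a' x = second_order (second_order f v' a') v a x"
proof -
  note [simp] = psmooth_partial psmooth_sum psmooth_mult psmooth_const psmooth_add psmooth_second_order assms
  have "second_order (second_order f v a) v' a' x =
    (\<Sum>i\<in>UNIV. (\<Sum>j\<in>UNIV. second_order (partial j (partial i f)) v a x * v' $ j) * v' $ i
      + second_order (partial i f) v a x * a' $ i)"
    by (simp add: second_order_def[of "second_order f v a"] partial_second_order)
  also have "\<dots> = second_order (second_order f v' a') v a x"
    by (simp add: second_order_def[of f v' a', abs_def] second_order_sum second_order_add second_order_cmult)
  finally show ?thesis .
qed

section \<open>Iterated directional derivatives\<close>

definition dir_deriv :: "real^'n \<Rightarrow> (real^'n \<Rightarrow> real) \<Rightarrow> real^'n \<Rightarrow> real" where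
  "dir_deriv p f x = (\<Sum>i\<in>UNIV. partial i f x * p $ i)"

lemma psmooth_dir_deriv: "psmooth f \<Longrightarrow> psmooth (dir_deriv p f)"
  unfolding dir_deriv_def[abs_def] by (intro psmooth_sum psmooth_mult psmooth_const psmooth_partial)

lemma dir_deriv_const: "dir_deriv p (\<lambda>x. c) = (\<lambda>x. 0)"
  by (simp add: dir_deriv_def[abs_def] partial_const)

lemma dir_deriv_add:
  assumes "psmooth f" "psmooth g"
  shows "dir_deriv p (\<lambda>x. f x + g x) = (\<lambda>x. dir_deriv p f x + dir_deriv p g x)"
  by (simp add: dir_deriv_def[abs_def] partial_add_psmooth assms sum.distrib algebra_simps)

lemma dir_deriv_mult:
  assumes "psmooth f" "psmooth g"
  shows "dir_deriv p (\<lambda>x. f x * g x) = (\<lambda>x. f x * dir_deriv p g x + dir_deriv p f x * g x)"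
  by (simp add: fun_eq_iff dir_deriv_def partial_mult psmooth_differentiable assms sum.distrib
      sum_distrib_left sum_distrib_right algebra_simps)

lemma dir_deriv_sum:
  assumes "\<And>i. i \<in> A \<Longrightarrow> psmooth (f i)"
  shows "dir_deriv p (\<lambda>x. \<Sum>i\<in>A. f i x) = (\<lambda>x. \<Sum>i\<in>A. dir_deriv p (f i) x)"
  using assms
  by (induction A rule: infinite_finite_induct)
    (simp_all add: dir_deriv_const dir_deriv_add psmooth_sum)

lemma dir_deriv_cmult:
  assumes "psmooth f"
  shows "dir_deriv p (\<lambda>x. c * f x) = (\<lambda>x. c * dir_deriv p f x)"
  by (simp add: dir_deriv_mult dir_deriv_const psmooth_const assms)

lemma has_vector_derivative_line: "((\<lambda>t. t *\<^sub>R p + q) has_vector_derivative p) (at t)"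
  by (auto intro!: derivative_eq_intros simp: has_vector_derivative_def)

lemma has_real_derivative_line:
  "psmooth f \<Longrightarrow> ((\<lambda>t. f (t *\<^sub>R p + q)) has_real_derivative dir_deriv p f (t *\<^sub>R p + q)) (at t)"
  using has_real_derivative_psmooth_compose[OF _ has_vector_derivative_line]
  by (simp add: dir_deriv_def)

lemma deriv2_line:
  assumes "psmooth f"
  shows "(deriv ^^ 2) (\<lambda>t. f (t *\<^sub>R p + q)) 0 = dir_deriv p (dir_deriv p f) q"
  by (rule deriv2_eqI[of UNIV])
    (use has_real_derivative_line[OF assms]
      has_real_derivative_line[OF psmooth_dir_deriv[OF assms], where t = 0 and p = p and q = q] in auto)

section \<open>Derivatives along lines in the dual variable\<close>

context uniformly_convex_potential
begin

text \<open>Supplies the velocity and acceleration that \<open>deriv2_psmooth_compose\<close> asks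
  of the curve t \<mapsto> DH*(tp + q).\<close>

lemma deriv2_grad_inv_line:
  "\<exists>\<gamma>' a. (\<forall>t. ((\<lambda>t. grad_inv (t *\<^sub>R p + q)) has_vector_derivative \<gamma>' t) (at t)) \<and>
    (\<gamma>' has_vector_derivative a) (at 0)"
proof -
  let ?g = "\<lambda>i z. grad_inv z $ i"
  have g: "psmooth (?g i)" for i
    by (rule psmooth_comp_grad_inv[OF psmooth_coordinate])
  define \<gamma>' where "\<gamma>' = (\<lambda>t. \<chi> i. dir_deriv p (?g i) (t *\<^sub>R p + q))"
  define a where "a = (\<chi> i. dir_deriv p (dir_deriv p (?g i)) q)"
  have "((\<lambda>t. grad_inv (t *\<^sub>R p + q)) has_vector_derivative \<gamma>' t) (at t)" for t
    using has_real_derivative_line[OF g]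
    by (intro has_vector_derivative_vec_componentwise) (simp add: \<gamma>'_def)
  moreover have "(\<gamma>' has_vector_derivative a) (at 0)"
    using has_real_derivative_line[OF psmooth_dir_deriv[OF g], where t = 0 and p = p and q = q]
    by (intro has_vector_derivative_vec_componentwise) (simp add: \<gamma>'_def a_def)
  ultimately show ?thesis by blast
qed

text \<open>With B = D^2 H* and BW = v, differentiating along p gives BW' = - B'W and BW'' = - 2
  B'W' - B''W. Since B is symmetric, v \<bullet> W'' = W \<bullet> BW'', and W' = - B^(-1) B'W is
  inserted.\<close>

lemma dir_deriv2_hessian_grad_inv:
  fixes p v X
  defines "w \<equiv> hessian H X *v v"
    and "B1 \<equiv> \<chi> i j. dir_deriv p (partial i (partial j (legendre H))) (grad H X)"
    and "B2 \<equiv> \<chi> i j. dir_deriv p (dir_deriv p (partial i (partial j (legendre H)))) (grad H X)"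
  shows "dir_deriv p (dir_deriv p (\<lambda>z. v \<bullet> (hessian H (grad_inv z) *v v))) (grad H X)
    = - (w \<bullet> (B2 *v w)) + 2 * (w \<bullet> (B1 *v (hessian H X *v (B1 *v w))))"
proof -
  define W where "W = (\<lambda>i z. (hessian H (grad_inv z) *v v) $ i)"
  define B where "B = (\<lambda>i j. partial i (partial j (legendre H)))"
  let ?D = "dir_deriv p" and ?q = "grad H X"
  let ?B = "\<chi> i j. B i j ?q" and ?w1 = "\<chi> i. ?D (W i) ?q" and ?w2 = "\<chi> i. ?D (?D (W i)) ?q"
  have W: "psmooth (W i)" for i
    unfolding W_def matrix_vector_mult_def hessian_def
    by (simp, intro psmooth_sum psmooth_mult psmooth_const psmooth_comp_grad_inv psmooth_partial smooth)
  have W_apply: "(hessian H (grad_inv z) *v v) $ i = W i z" for i z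
    by (simp add: W_def)
  have B: "psmooth (B i j)" for i j
    unfolding B_def by (intro psmooth_partial psmooth_legendre)
  note [simp] = W B psmooth_dir_deriv psmooth_sum psmooth_mult psmooth_add psmooth_const
  have BW: "(\<lambda>z. \<Sum>j\<in>UNIV. B i j z * W j z) = (\<lambda>z. v $ i)" for i
  proof
    fix z
    have "(\<Sum>j\<in>UNIV. B i j z * W j z) = (hessian (legendre H) z *v (hessian H (grad_inv z) *v v)) $ i"
      unfolding matrix_vector_mult_def[of "hessian (legendre H) z"]
      by (simp add: W_def B_def hessian_def[of "legendre H"])
    also have "hessian (legendre H) z *v (hessian H (grad_inv z) *v v) = v"
      by (simp add: matrix_vector_mul_assoc hessian_legendre matrix_inv_hessian)
    finally show "(\<Sum>j\<in>UNIV. B i j z * W j z) = v $ i" .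
  qed
  have D1: "?D (\<lambda>z. \<Sum>j\<in>UNIV. B i j z * W j z) = (\<lambda>z. \<Sum>j\<in>UNIV. B i j z * ?D (W j) z + ?D (B i j) z * W j z)" for i
    by (simp add: dir_deriv_sum dir_deriv_mult)
  have D2: "?D (?D (\<lambda>z. \<Sum>j\<in>UNIV. B i j z * W j z)) = (\<lambda>z. \<Sum>j\<in>UNIV.
      B i j z * ?D (?D (W j)) z + 2 * (?D (B i j) z * ?D (W j) z) + ?D (?D (B i j)) z * W j z)" for i
    unfolding D1 by (simp add: dir_deriv_sum dir_deriv_mult dir_deriv_add algebra_simps)
  have w: "w = (\<chi> i. W i ?q)"
    by (simp add: w_def W_def)
  have B_eq: "?B = hessian (legendre H) ?q"
    by (simp add: hessian_def B_def)
  have "?B *v w = v"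
    unfolding B_eq w_def by (simp add: matrix_vector_mul_assoc hessian_legendre_hessian)
  have B1_eq: "B1 = (\<chi> i j. ?D (B i j) ?q)" and B2_eq: "B2 = (\<chi> i j. ?D (?D (B i j)) ?q)"
    by (simp_all add: B1_def B2_def B_def)
  have "?B *v ?w1 + B1 *v w = 0"
    using D1 unfolding BW
    by (simp add: vec_eq_iff matrix_vector_mult_def w B1_eq dir_deriv_const fun_eq_iff sum.distrib)
  \<comment> \<open>Multiplying by D^2 H(X), which is the inverse of \<open>?B\<close>, solves for
    \<open>?w1\<close>.\<close>
  then have "hessian H X *v (?B *v ?w1) = - (hessian H X *v (B1 *v w))"
    by (simp add: eq_neg_iff_add_eq_0 flip: matrix_vector_right_distrib)
  then have w1: "?w1 = - (hessian H X *v (B1 *v w))"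
    by (simp add: B_eq matrix_vector_mul_assoc hessian_legendre matrix_inv_hessian)
  have w2: "?B *v ?w2 + 2 *\<^sub>R (B1 *v ?w1) + B2 *v w = 0"
    using D2 unfolding BW
    by (simp add: vec_eq_iff matrix_vector_mult_def w B1_eq B2_eq dir_deriv_const
        fun_eq_iff sum.distrib sum_distrib_left)
  have "?D (?D (\<lambda>z. v \<bullet> (hessian H (grad_inv z) *v v))) ?q = v \<bullet> ?w2"
    by (simp add: inner_vec_def W_apply dir_deriv_sum dir_deriv_cmult)
  also have "\<dots> = (?B *v w) \<bullet> ?w2"
    using \<open>?B *v w = v\<close> by simp
  \<comment> \<open>Symmetry of \<open>?B\<close> moves it onto \<open>?w2\<close>, where the twice
    differentiated equation applies.\<close>
  also have "\<dots> = w \<bullet> (?B *v ?w2)"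
    by (simp add: B_eq dot_lmul_matrix[symmetric] transpose_hessian psmooth_legendre
        flip: transpose_matrix_vector)
  also have "?B *v ?w2 = - (2 *\<^sub>R (B1 *v ?w1)) - B2 *v w"
    using w2 by (simp add: algebra_simps eq_neg_iff_add_eq_0)
  also have "w \<bullet> \<dots> = - (w \<bullet> (B2 *v w)) + 2 * (w \<bullet> (B1 *v (hessian H X *v (B1 *v w))))"
    unfolding w1 by (simp add: inner_diff_right vec.neg)
  finally show ?thesis .
qed

lemma psmooth_quadratic: "psmooth (\<lambda>z. v \<bullet> (hessian H (grad_inv z) *v v))"
  unfolding inner_vec_def matrix_vector_mult_def hessian_def
  by (simp, intro psmooth_sum psmooth_mult psmooth_const psmooth_comp_grad_inv psmooth_partial smooth)

text \<open>Both pairs of derivatives become constant-coefficient operators on H evaluated at x + y.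
  Commuting them leaves a function of the dual variable alone, from which \<beta>'' drops
  out.\<close>

lemma deriv4_curve:
  assumes "smooth_curve_through \<beta> x v"
  shows "(deriv ^^ 2) (\<lambda>s. (deriv ^^ 2) (\<lambda>t. H (\<beta> s + (grad_inv (t *\<^sub>R p + grad H (x + y)) - x))) 0) 0
    = dir_deriv p (dir_deriv p (\<lambda>z. v \<bullet> (hessian H (grad_inv z) *v v))) (grad H (x + y))"
proof -
  let ?X = "x + y" and ?q = "grad H (x + y)"
  let ?\<gamma> = "\<lambda>t. grad_inv (t *\<^sub>R p + ?q)"
  obtain \<epsilon> where "\<epsilon> > 0" and sm: "smooth_on {-\<epsilon><..<\<epsilon>} \<beta>" and \<beta>0: "\<beta> 0 = x"
    and \<beta>v: "(\<beta> has_vector_derivative v) (at 0)"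
    using assms by (auto simp: smooth_curve_through_def)
  define \<beta>' where "\<beta>' = (\<lambda>s. frechet_derivative \<beta> (at s) 1)"
  define a where "a = frechet_derivative \<beta>' (at 0) 1"
  have D: "(f has_vector_derivative frechet_derivative f (at s) 1) (at s)"
    if "f differentiable (at s)" for f :: "real \<Rightarrow> real^'n" and s
  proof -
    from that have F: "(f has_derivative frechet_derivative f (at s)) (at s)"
      by (simp add: frechet_derivative_works)
    then interpret bounded_linear "frechet_derivative f (at s)" by (rule has_derivative_bounded_linear)
    show ?thesis
      unfolding has_vector_derivative_def
      by (rule has_derivative_eq_rhs[OF F]) (simp add: fun_eq_iff flip: scaleR)
  qed
  \<comment> \<open>Order two provides velocity and acceleration on the whole interval; the
    recursive definition is kept folded until it can be unfolded twice.\<close>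
  have "Ck_on (Suc (Suc 0)) {-\<epsilon><..<\<epsilon>} \<beta>"
    using sm by (simp add: smooth_on_def del: Ck_on.simps)
  then have d1: "(\<beta> has_vector_derivative \<beta>' s) (at s)" and d2: "(\<beta>' has_vector_derivative frechet_derivative \<beta>' (at s) 1) (at s)"
    if "s \<in> {-\<epsilon><..<\<epsilon>}" for s
    using that D by (auto simp: \<beta>'_def)
  have \<beta>'0: "\<beta>' 0 = v"
    using d1[of 0] \<beta>v \<open>\<epsilon> > 0\<close> by (auto intro: vector_derivative_unique_at)
  obtain \<gamma>' \<gamma>2 where \<gamma>: "\<And>t. (?\<gamma> has_vector_derivative \<gamma>' t) (at t)" "(\<gamma>' has_vector_derivative \<gamma>2) (at 0)"
    using deriv2_grad_inv_line[of p ?q] by blast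
  have inner: "(deriv ^^ 2) (\<lambda>t. H (\<beta> s + (?\<gamma> t - x))) 0 = second_order H (\<gamma>' 0) \<gamma>2 (\<beta> s + y)" for s
  proof -
    have "((\<lambda>t. \<beta> s + (?\<gamma> t - x)) has_vector_derivative \<gamma>' t) (at t)" for t
      using has_vector_derivative_add[OF has_vector_derivative_const[of "\<beta> s - x"] \<gamma>(1)]
      by (simp add: algebra_simps)
    from deriv2_psmooth_compose[OF smooth open_UNIV UNIV_I this \<gamma>(2)] show ?thesis by simp
  qed
  have "(deriv ^^ 2) (\<lambda>s. second_order H (\<gamma>' 0) \<gamma>2 (\<beta> s + y)) 0
      = second_order (second_order H (\<gamma>' 0) \<gamma>2) v a (\<beta> 0 + y)"
    unfolding \<beta>'0[symmetric]
  proof (rule deriv2_psmooth_compose[where S = "{-\<epsilon><..<\<epsilon>}"])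
    show "((\<lambda>s. \<beta> s + y) has_vector_derivative \<beta>' s) (at s)" if "s \<in> {-\<epsilon><..<\<epsilon>}" for s
      using has_vector_derivative_add[OF d1[OF that] has_vector_derivative_const[of y]] by simp
    show "(\<beta>' has_vector_derivative a) (at 0)"
      unfolding a_def using d2[of 0] \<open>\<epsilon> > 0\<close> by simp
  qed (use \<open>\<epsilon> > 0\<close> in \<open>auto intro: psmooth_second_order smooth\<close>)
  \<comment> \<open>Here the s- and t-derivatives change places; the base points match since
    \<open>\<beta> 0 + y\<close> and \<open>?\<gamma> 0\<close> are both x + y.\<close>
  also have "\<dots> = second_order (second_order H v a) (\<gamma>' 0) \<gamma>2 (?\<gamma> 0)"
    by (simp add: second_order_commute[OF smooth, of _ _ v] \<beta>0)
  also have "\<dots> = (deriv ^^ 2) (\<lambda>t. second_order H v a (?\<gamma> t)) 0"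
    using deriv2_psmooth_compose[OF psmooth_second_order[OF smooth] open_UNIV UNIV_I \<gamma>] by simp
  also have "\<dots> = dir_deriv p (dir_deriv p (\<lambda>z. second_order H v a (grad_inv z))) ?q"
    by (intro deriv2_line psmooth_comp_grad_inv psmooth_second_order smooth)
  \<comment> \<open>The gradient of H at \<open>grad_inv z\<close> is z, so the acceleration enters
    only through a term linear in z. One derivative along p makes it constant and the next one
    removes it.\<close>
  also have "(\<lambda>z. second_order H v a (grad_inv z)) =
      (\<lambda>z. v \<bullet> (hessian H (grad_inv z) *v v) + (\<Sum>i\<in>UNIV. a $ i * z $ i))"
  proof
    fix z
    have "partial i H (grad_inv z) = z $ i" for i
      using grad_grad_inv[of z] by (simp add: grad_def vec_eq_iff)
    then show "second_order H v a (grad_inv z) = v \<bullet> (hessian H (grad_inv z) *v v) + (\<Sum>i\<in>UNIV. a $ i * z $ i)"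
      by (simp add: second_order_def inner_vec_def hessian_def matrix_vector_mult_def
          partial_commute[OF smooth] sum.distrib mult.commute)
  qed
  also have "dir_deriv p \<dots> = (\<lambda>z. dir_deriv p (\<lambda>z. v \<bullet> (hessian H (grad_inv z) *v v)) z + (\<Sum>i\<in>UNIV. a $ i * p $ i))"
  proof -
    have "dir_deriv p (\<lambda>z. z $ i) = (\<lambda>z. p $ i)" for i
      by (simp add: dir_deriv_def[abs_def] partial_eq_has_derivative[OF bounded_linear_imp_has_derivative[OF bounded_linear_vec_nth]]
          axis_def if_distrib if_distribR cong: if_cong)
    then show ?thesis
      by (subst dir_deriv_add) (simp_all add: dir_deriv_sum dir_deriv_cmult psmooth_quadratic psmooth_sum psmooth_mult psmooth_const psmooth_coordinate)
  qed
  finally show ?thesis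
    by (simp add: inner dir_deriv_add dir_deriv_const psmooth_dir_deriv psmooth_quadratic psmooth_const)
qed

end

section \<open>The MTW curvature\<close>

lemma partial_translate: "partial i (\<lambda>x. f (x + y)) x = partial i f (x + y)"
  unfolding partial_def by (simp add: ac_simps)

lemma Ck_on_const: "Ck_on k S (\<lambda>x. c)"
  by (induction k arbitrary: c) auto

lemma smooth_curve_through_line: "smooth_curve_through (\<lambda>s. x + s *\<^sub>R v) x v"
proof -
  have D: "((\<lambda>s. x + s *\<^sub>R v) has_derivative (\<lambda>h. h *\<^sub>R v)) (at s)" for s
    by (auto intro!: derivative_eq_intros)
  have "Ck_on k S (\<lambda>s. x + s *\<^sub>R v)" for k S
  proof (cases k)
    case (Suc l)
    then show ?thesis
      using D by (auto simp: Ck_on_const frechet_derivative_at[OF D, symmetric] differentiable_def)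
  qed (auto intro!: continuous_intros)
  then show ?thesis
    unfolding smooth_curve_through_def smooth_on_def has_vector_derivative_def
    using D[of 0] by (auto intro!: exI[of _ "1::real"])
qed

text \<open>The straight line rules out a vacuous quantifier over curves, so the value in the
  definite description is unique.\<close>

lemma MTW_eqI:
  assumes "\<And>\<beta>. smooth_curve_through \<beta> x v \<Longrightarrow>
    (deriv ^^ 2) (\<lambda>s. (deriv ^^ 2) (\<lambda>t. b (\<beta> s) (b_exp b x
      (t *\<^sub>R (mixed_hessian b x y *v u) + grad_x b x y))) 0) 0 = m"
  shows "MTW b x y v u = m"
  unfolding MTW_def Let_def
  by (rule the_equality) (use assms smooth_curve_through_line[of x v] in blast)+

text \<open>The iterated sums become one sum over tuples, on which the change of order is a
  bijective reindexing.\<close>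

lemma sum_swap_five:
  fixes f :: "'i::finite \<Rightarrow> 'i \<Rightarrow> 'i \<Rightarrow> 'i \<Rightarrow> 'i \<Rightarrow> real"
  shows "(\<Sum>l\<in>UNIV. \<Sum>r\<in>UNIV. \<Sum>j\<in>UNIV. \<Sum>a\<in>UNIV. \<Sum>k\<in>UNIV. f l r j k a)
    = (\<Sum>j\<in>UNIV. \<Sum>k\<in>UNIV. \<Sum>l\<in>UNIV. \<Sum>a\<in>UNIV. \<Sum>r\<in>UNIV. f l r j k a)"
proof -
  have "(\<Sum>l\<in>UNIV. \<Sum>r\<in>UNIV. \<Sum>j\<in>UNIV. \<Sum>a\<in>UNIV. \<Sum>k\<in>UNIV. f l r j k a)
    = sum (\<lambda>(l, r, j, a, k). f l r j k a) UNIV"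
    by (simp add: sum.cartesian_product flip: UNIV_Times_UNIV)
  also have "\<dots> = sum (\<lambda>(j, k, l, a, r). f l r j k a) UNIV"
    by (rule sum.reindex_bij_witness[of _ "\<lambda>(j, k, l, a, r). (l, r, j, a, k)" "\<lambda>(l, r, j, a, k). (j, k, l, a, r)"]) auto
  also have "\<dots> = (\<Sum>j\<in>UNIV. \<Sum>k\<in>UNIV. \<Sum>l\<in>UNIV. \<Sum>a\<in>UNIV. \<Sum>r\<in>UNIV. f l r j k a)"
    by (simp add: sum.cartesian_product flip: UNIV_Times_UNIV)
  finally show ?thesis .
qed

section \<open>The curvature of H(x + y) in index form\<close>

context uniformly_convex_potential
begin

lemma MTW_translation:
  assumes b: "\<And>x y. b x y = H (x + y)"
  defines "p x y u \<equiv> hessian H (x + y) *v u"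
  shows "MTW b x y v u =
    dir_deriv (p x y u) (dir_deriv (p x y u) (\<lambda>z. v \<bullet> (hessian H (grad_inv z) *v v))) (grad H (x + y))"
proof (rule MTW_eqI)
  fix \<beta> assume \<beta>: "smooth_curve_through \<beta> x v"
  have "partial i (\<lambda>x'. b x' y') x' = partial i H (x' + y')" for i x' y'
    unfolding b by (rule partial_translate)
  then have gx: "grad_x b x' y' = grad H (x' + y')" for x' y'
    by (simp add: grad_x_def grad_def)
  have "partial j (\<lambda>y'. b x' y') y' = partial j H (x' + y')" for j x' y'
    unfolding b using partial_translate[of j H x' y'] by (simp add: add.commute)
  then have mh: "mixed_hessian b x y = hessian H (x + y)"
    by (simp add: mixed_hessian_def hessian_def partial_translate)
  \<comment> \<open>The equation DH(x + y') = z is solved by y' = \<open>grad_inv z - x\<close>, and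
    injectivity of DH makes this the value of \<open>inv\<close>.\<close>
  have be: "b_exp b x z = grad_inv z - x" for z
    unfolding b_exp_def
  proof (rule inv_f_eq)
    show "inj (grad_x b x)"
      by (rule injI) (auto simp: gx dest: injD[OF inj_grad])
  qed (simp add: gx)
  show "(deriv ^^ 2) (\<lambda>s. (deriv ^^ 2) (\<lambda>t. b (\<beta> s) (b_exp b x
      (t *\<^sub>R (mixed_hessian b x y *v u) + grad_x b x y))) 0) 0 =
    dir_deriv (p x y u) (dir_deriv (p x y u) (\<lambda>z. v \<bullet> (hessian H (grad_inv z) *v v))) (grad H (x + y))"
    using deriv4_curve[OF \<beta>] by (simp add: b be mh gx p_def)
qed

lemma dir_deriv2_hessian_grad_inv_sum:
  fixes p v X
  defines "w \<equiv> hessian H X *v v" and "z \<equiv> grad H X" and "Hs \<equiv> legendre H"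
  shows "dir_deriv p (dir_deriv p (\<lambda>z. v \<bullet> (hessian H (grad_inv z) *v v))) z =
        - (\<Sum>i\<in>UNIV. \<Sum>j\<in>UNIV. \<Sum>k\<in>UNIV. \<Sum>l\<in>UNIV.
             partial i (partial j (partial k (partial l Hs))) z
             * p $ k * p $ l * w $ i * w $ j)
        + 2 * (\<Sum>i\<in>UNIV. \<Sum>j\<in>UNIV. \<Sum>k\<in>UNIV. \<Sum>l\<in>UNIV. \<Sum>a\<in>UNIV. \<Sum>r\<in>UNIV.
             partial i (partial l (partial k Hs)) z
             * partial r (partial j (partial a Hs)) z
             * partial l (partial r H) X
             * w $ i * w $ j * p $ a * p $ k)"
proof -
  have Hs: "psmooth Hs"
    unfolding Hs_def by (rule psmooth_legendre)
  note sm = Hs psmooth_partial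
  \<comment> \<open>Differentiating along p puts the new indices outermost; here and in
    \<open>c4\<close> they are moved innermost, as in the target formula.\<close>
  have c3: "partial k (partial i (partial j Hs)) = partial i (partial j (partial k Hs))" for i j k
    by (metis partial_commute sm)
  have c4: "partial k (partial l (partial i (partial j Hs))) = partial i (partial j (partial k (partial l Hs)))" for i j k l
    by (metis partial_commute sm)
  have D1: "dir_deriv p (partial i (partial j Hs)) z = (\<Sum>k\<in>UNIV. partial i (partial j (partial k Hs)) z * p $ k)" for i j
    unfolding dir_deriv_def by (intro sum.cong refl, subst c3) (rule refl)
  have D2: "dir_deriv p (dir_deriv p (partial i (partial j Hs))) z =
      (\<Sum>k\<in>UNIV. \<Sum>l\<in>UNIV. partial i (partial j (partial k (partial l Hs))) z * p $ l * p $ k)" for i j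
  proof -
    have "dir_deriv p (partial i (partial j Hs)) = (\<lambda>z. \<Sum>l\<in>UNIV. partial l (partial i (partial j Hs)) z * p $ l)"
      by (simp add: dir_deriv_def[abs_def])
    then show ?thesis
      by (simp add: dir_deriv_def[of p "\<lambda>z. \<Sum>l\<in>UNIV. _ l z"] partial_sum partial_cmult psmooth_mult psmooth_const sm c4 sum_distrib_right)
  qed
  have 1: "w \<bullet> ((\<chi> i j. dir_deriv p (dir_deriv p (partial i (partial j Hs))) z) *v w) =
      (\<Sum>i\<in>UNIV. \<Sum>j\<in>UNIV. \<Sum>k\<in>UNIV. \<Sum>l\<in>UNIV.
             partial i (partial j (partial k (partial l Hs))) z * p $ k * p $ l * w $ i * w $ j)"
    by (simp add: inner_vec_def matrix_vector_mult_def D2 sum_distrib_left sum_distrib_right mult_ac)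
  let ?B1 = "\<chi> i j. dir_deriv p (partial i (partial j Hs)) z"
  \<comment> \<open>Expanding the matrix products from the left nests the sums in the order i, l, r,
    j, a, k. The left \<open>?B1\<close> contributes the contraction over k and the right one that
    over a.\<close>
  have "w \<bullet> (?B1 *v (hessian H X *v (?B1 *v w))) =
      (\<Sum>i\<in>UNIV. \<Sum>l\<in>UNIV. \<Sum>r\<in>UNIV. \<Sum>j\<in>UNIV. \<Sum>a\<in>UNIV. \<Sum>k\<in>UNIV.
             partial i (partial l (partial k Hs)) z
             * partial r (partial j (partial a Hs)) z
             * partial l (partial r H) X
             * w $ i * w $ j * p $ a * p $ k)"
    by (simp add: inner_vec_def matrix_vector_mult_def hessian_def D1 sum_distrib_left sum_distrib_right mult_ac)
  also have "\<dots> = (\<Sum>i\<in>UNIV. \<Sum>j\<in>UNIV. \<Sum>k\<in>UNIV. \<Sum>l\<in>UNIV. \<Sum>a\<in>UNIV. \<Sum>r\<in>UNIV.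
             partial i (partial l (partial k Hs)) z
             * partial r (partial j (partial a Hs)) z
             * partial l (partial r H) X
             * w $ i * w $ j * p $ a * p $ k)"
    by (rule sum.cong[OF refl]) (rule sum_swap_five)
  finally have 2: "w \<bullet> (?B1 *v (hessian H X *v (?B1 *v w))) = \<dots>" .
  show ?thesis
    using dir_deriv2_hessian_grad_inv[of p v X] 1 2 unfolding w_def z_def Hs_def by simp
qed

end

theorem mainTheorem2:
  fixes H :: "real^'n \<Rightarrow> real"
    and h g b :: "real^'n \<Rightarrow> real^'n \<Rightarrow> real"
  assumes H_smooth: "smooth_on UNIV H"
    and H_convex: "uniformly_convex H"
    and h_def: "\<And>x z. h x z = x \<bullet> z - legendre H z"
    and g_def: "\<And>y z. g y z = y \<bullet> z"
    and b_def: "\<And>x y. b x y = (SUP z. h x z + g y z)"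
  shows "(\<forall>x y. b x y = H (x + y)) \<and>
    (\<forall>x y v u.
      let p = hessian H (x + y) *v u;
          w = hessian H (x + y) *v v;
          z = grad H (x + y);
          Hs = legendre H
      in MTW b x y v u =
        - (\<Sum>i\<in>UNIV. \<Sum>j\<in>UNIV. \<Sum>k\<in>UNIV. \<Sum>l\<in>UNIV.
             partial i (partial j (partial k (partial l Hs))) z
             * p $ k * p $ l * w $ i * w $ j)
        + 2 * (\<Sum>i\<in>UNIV. \<Sum>j\<in>UNIV. \<Sum>k\<in>UNIV. \<Sum>l\<in>UNIV. \<Sum>a\<in>UNIV. \<Sum>r\<in>UNIV.
             partial i (partial l (partial k Hs)) z
             * partial r (partial j (partial a Hs)) z
             * partial l (partial r H) (x + y)
             * w $ i * w $ j * p $ a * p $ k))"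
proof -
  have H: "psmooth H"
    using H_smooth by (rule psmooth_smooth_on)
  obtain c where "c > 0" "\<And>x \<xi>. c * (\<xi> \<bullet> \<xi>) \<le> \<xi> \<bullet> (hessian H x *v \<xi>)"
    using H_convex unfolding uniformly_convex_def by blast
  with H interpret uniformly_convex_potential H c
    by unfold_locales
  \<comment> \<open>The function under the supremum is (x + y) \<bullet> z - H*(z), so b is the
    biconjugate of H at x + y.\<close>
  have b: "b x y = H (x + y)" for x y
    using biconjugate[of "x + y"] by (simp add: b_def h_def g_def inner_left_distrib algebra_simps)
  show ?thesis
    unfolding Let_def
    by (intro conjI allI b) (simp only: MTW_translation[OF b] dir_deriv2_hessian_grad_inv_sum)
qed

end
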